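(* Fix $t>0$ and let $A_t=\{z\in\mathbb C:e^{-\frac t2}\le|z|\le e^{\frac t2}\}$. Then $\overline{\Sigma_{s,t}}\to A_t$ in Hausdorff distance as $s\to\infty$.
   Context: $\mathbb D$ is the open unit disk, $\mathbb C_\infty$ the Riemann sphere. For $r\in\mathbb R$ let $f_r(z)=z\exp\big(\frac r2\frac{1+z}{1-z}\big)$. For $s>0$ let $\Omega_s=\{z\in\mathbb D:f_s(z)\in\mathbb D\}$. Known: $f_s$ maps $\Omega_s$ conformally onto $\mathbb D$ and extends to a homeomorphism $\overline{\Omega_s}\to\overline{\mathbb D}$, whose inverse is denoted $\chi_s:\overline{\mathbb D}\to\overline{\Omega_s}$, and $1\notin\overline{\Omega_s}$. Put $\chi_{s,t}=f_{s-t}\circ\chi_s$ on $\overline{\mathbb D}$ (injective with values in $\overline{\mathbb D}$ for $s\ge\frac t2>0$), $K=\chi_{s,t}(\overline{\mathbb D})$, and $\Sigma_{s,t}=\mathbb C_\infty\setminus(K\cup\{1/z:z\in K\})$, an open subset of $\mathbb C\setminus\{0\}$ whose closure is compact in $\mathbb C$. *)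

theory Defs
  imports "HOL-Analysis.Analysis"
begin

(* The value at z = 1 is a division-by-zero artefact; it plays no role because
   1 lies outside the closure of \<Omega>_s. *)
definition f_map :: "real \<Rightarrow> complex \<Rightarrow> complex" where
  "f_map r z = z * exp (of_real (r / 2) * ((1 + z) / (1 - z)))"

definition Omega :: "real \<Rightarrow> complex set" where
  "Omega s = {z \<in> ball 0 1. f_map s z \<in> ball 0 1}"

(* Since 1 is not in the closure of \<Omega>_s, the formula for f_s is continuous there,
   so the continuous extension of f_s to that closure is again given by f_map s.
   chi s is meant on cball 0 1 only. *)
definition chi :: "real \<Rightarrow> complex \<Rightarrow> complex" where
  "chi s = inv_into (closure (Omega s)) (f_map s)"

definition chi2 :: "real \<Rightarrow> real \<Rightarrow> complex \<Rightarrow> complex" where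
  "chi2 s t = f_map (s - t) \<circ> chi s"

definition K_set :: "real \<Rightarrow> real \<Rightarrow> complex set" where
  "K_set s t = chi2 s t ` cball 0 1"

(* The complement is taken in the Riemann sphere.  Because 0 is in K (lemma zero_in_K_set),
   the sphere set {1/z : z in K} contains \<infinity> = 1/0, so \<infinity> is not in the complement and the
   latter is a subset of the complex plane.  The value 1/0 = 0 used by HOL is harmless, as 0
   is removed anyway. *)
definition Sigma_set :: "real \<Rightarrow> real \<Rightarrow> complex set" where
  "Sigma_set s t = - (K_set s t \<union> {1 / z | z. z \<in> K_set s t})"

definition annulus :: "real \<Rightarrow> complex set" where
  "annulus t = {z. exp (- t / 2) \<le> norm z \<and> norm z \<le> exp (t / 2)}"

(* Extended-valued, so that the distance from the empty set to a nonempty set is \<infinity>. *)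
definition hausdorff_dist :: "'a::metric_space set \<Rightarrow> 'a set \<Rightarrow> ennreal" where
  "hausdorff_dist A B =
     max (SUP a\<in>A. INF b\<in>B. ennreal (dist a b)) (SUP b\<in>B. INF a\<in>A. ennreal (dist a b))"

lemma zero_in_K_set: "0 \<in> K_set s t"
proof -
  have f0: "f_map r z = 0 \<longleftrightarrow> z = 0" for r z
    by (simp add: f_map_def)
  have "0 \<in> closure (Omega s)"
    by (rule subsetD[OF closure_subset]) (simp add: Omega_def f_map_def)
  then have "0 \<in> f_map s ` closure (Omega s)"
    using f0 by (metis imageI)
  then have "f_map s (chi s 0) = 0"
    unfolding chi_def by (rule f_inv_into_f)
  then have "chi2 s t 0 = 0"
    by (simp add: chi2_def f0)
  then show ?thesis
    unfolding K_set_def by (metis centre_in_cball imageI zero_le_one)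
qed

end

theory Submission
  imports Defs "HOL-Real_Asymp.Real_Asymp"
begin

text \<open>For large \<open>s\<close> the domain \<open>Omega s\<close> shrinks to the origin, where \<open>(1 + z) / (1 - z)\<close> is close
  to \<open>1\<close>.  Since \<open>f_map (s - t) z = f_map s z * exp (- t / 2 * (1 + z) / (1 - z))\<close>, the set
  \<open>K_set s t\<close> is squeezed between two discs about \<open>0\<close> whose radii tend to \<open>exp (- t / 2)\<close>, and hence
  \<open>Sigma_set s t\<close> between two annuli tending to \<open>annulus t\<close>.  The equation \<open>f_map s z = w\<close> is solved
  near the origin as the fixed point equation of the contraction
  \<open>z \<mapsto> w * exp (- s / 2 * (1 + z) / (1 - z))\<close>.\<close>

section \<open>The Cayley transform near the origin and on the unit disk\<close>

text \<open>The difference is \<open>2 * z / (1 - z)\<close> with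
  \<open>norm (1 - z) >= 3 / 4\<close>, hence at most \<open>8 / 3 * d\<close>. Rounding up to
  \<open>4 * d\<close> makes the bound strict, which later puts \<open>K_set s t\<close> inside an
  open ball.\<close>

lemma cayley_dist_one_less:
  fixes z :: complex
  assumes "0 < d" "d \<le> 1 / 4" "norm z \<le> d"
  shows "norm ((1 + z) / (1 - z) - 1) < 4 * d"
proof -
  have nz: "1 - norm z \<le> norm (1 - z)"
    using norm_triangle_ineq2[of 1 z] by simp
  then have pos: "norm (1 - z) \<ge> 3 / 4" "1 - z \<noteq> 0"
    using assms by auto
  have "(1 + z) / (1 - z) - 1 = 2 * z / (1 - z)"
    using pos(2) by (simp add: field_simps)
  then have "norm ((1 + z) / (1 - z) - 1) = 2 * norm z / norm (1 - z)"
    by (simp add: norm_divide norm_mult)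
  also have "\<dots> \<le> 2 * d / (3 / 4)"
    using assms pos by (intro frac_le) auto
  also have "\<dots> < 4 * d"
    using assms by simp
  finally show ?thesis .
qed

lemma Re_cayley_bounds:
  fixes z :: complex
  assumes "0 < d" "d \<le> 1 / 4" "norm z \<le> d"
  shows "1 - 4 * d < Re ((1 + z) / (1 - z))" "Re ((1 + z) / (1 - z)) < 1 + 4 * d"
  using cayley_dist_one_less[OF assms] abs_Re_le_cmod[of "(1 + z) / (1 - z) - 1"] by auto

text \<open>The real part is the Poisson kernel \<open>(1 - |z|^2) / |1 - z|^2\<close>, which is at
  least \<open>(1 - |z|) / (1 + |z|)\<close>. Valid on the whole disk, it serves to locate
  \<open>Omega s\<close> before its points are known to be small.\<close>

lemma Re_cayley_ge:
  fixes z :: complex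
  assumes "norm z < 1"
  shows "(1 - norm z) / 2 \<le> Re ((1 + z) / (1 - z))"
proof -
  have pos: "0 < norm (1 - z)" "0 < 1 + norm z"
    using assms by (auto intro: add_pos_nonneg)
  have "Re ((1 + z) / (1 - z)) = Re ((1 + z) * cnj (1 - z)) / (norm (1 - z))\<^sup>2"
    by (subst complex_div_cnj) (simp add: Re_divide_of_real)
  also have "Re ((1 + z) * cnj (1 - z)) = 1 - (norm z)\<^sup>2"
    by (subst cmod_power2) (simp add: power2_eq_square algebra_simps)
  finally have eq: "Re ((1 + z) / (1 - z)) = (1 - (norm z)\<^sup>2) / (norm (1 - z))\<^sup>2" .
  have "norm (1 - z) \<le> 1 + norm z"
    using norm_triangle_ineq4[of 1 z] by simp
  then have "(norm (1 - z))\<^sup>2 \<le> (1 + norm z)\<^sup>2"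
    by (simp add: power_mono)
  moreover have "(norm z)\<^sup>2 \<le> 1"
    using assms by (simp add: power_le_one)
  ultimately have "(1 - (norm z)\<^sup>2) / (1 + norm z)\<^sup>2 \<le> Re ((1 + z) / (1 - z))"
    unfolding eq using pos by (intro divide_left_mono mult_pos_pos zero_less_power) linarith+
  moreover have "(1 - (norm z)\<^sup>2) / (1 + norm z)\<^sup>2 = (1 - norm z) / (1 + norm z)"
  proof -
    have "1 - (norm z)\<^sup>2 = (1 - norm z) * (1 + norm z)"
      by (simp add: power2_eq_square algebra_simps)
    then show ?thesis
      using pos by (simp add: power2_eq_square)
  qed
  moreover have "(1 - norm z) / 2 \<le> (1 - norm z) / (1 + norm z)"
    using assms pos by (intro divide_left_mono mult_pos_pos) auto
  ultimately show ?thesis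
    by linarith
qed

section \<open>Modulus of \<open>f_map\<close> and localisation of \<open>Omega s\<close>\<close>

lemma norm_f_map: "norm (f_map r z) = norm z * exp (r / 2 * Re ((1 + z) / (1 - z)))"
proof -
  have "Re (of_real (r / 2) * q) = r / 2 * Re q" for q
    by simp
  then show ?thesis
    by (simp only: f_map_def norm_mult norm_exp_eq_Re)
qed

lemma norm_f_map_diff:
  "norm (f_map (s - t) z) = norm (f_map s z) * exp (- (t / 2 * Re ((1 + z) / (1 - z))))"
proof -
  have "(s - t) / 2 * q = s / 2 * q + - (t / 2 * q)" for q
    by (simp add: algebra_simps diff_divide_distrib)
  then show ?thesis
    by (simp only: norm_f_map exp_add mult.assoc)
qed

lemma continuous_on_f_map: "d < 1 \<Longrightarrow> continuous_on (cball 0 d) (f_map r)"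
  unfolding f_map_def by (intro continuous_intros) auto

text \<open>If \<open>r = norm z > d\<close>, then \<open>- ln r\<close> is at most
  \<open>(1 - r) / d\<close>, while the exponent in \<open>norm_f_map\<close> is at least
  \<open>s / 4 * (1 - r)\<close>. Both bounds carry the factor \<open>1 - r\<close>, so a single
  threshold on \<open>s\<close> works up to the unit circle.\<close>

lemma Omega_subset_cball:
  assumes "0 < d" "4 / d \<le> s"
  shows "Omega s \<subseteq> cball 0 d"
proof
  fix z assume z: "z \<in> Omega s"
  define r where "r = norm z"
  have r1: "r < 1" and f1: "norm (f_map s z) < 1"
    using z by (auto simp: Omega_def r_def)
  have s0: "s > 0"
    using assms by (meson divide_pos_pos less_le_trans zero_less_numeral)
  show "z \<in> cball 0 d"
  proof (rule ccontr)
    assume "z \<notin> cball 0 d"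
    then have rd: "d < r" "0 < r"
      using assms by (auto simp: r_def)
    have "ln (1 / r) \<le> 1 / r - 1"
      using rd by (intro ln_le_minus_one) auto
    then have "- ln r \<le> (1 - r) / r"
      using rd by (simp add: ln_div diff_divide_distrib)
    also have "\<dots> \<le> (1 - r) / d"
      using rd r1 assms by (intro divide_left_mono) auto
    also have "\<dots> = (4 / d) / 4 * (1 - r)"
      by simp
    also have "\<dots> \<le> s / 4 * (1 - r)"
      using assms r1 by (intro mult_right_mono divide_right_mono) auto
    also have "\<dots> = s / 2 * ((1 - r) / 2)"
      by simp
    also have "\<dots> \<le> s / 2 * Re ((1 + z) / (1 - z))"
      using Re_cayley_ge[of z] r1 s0 by (intro mult_left_mono) (auto simp: r_def)
    finally have "exp 0 \<le> exp (ln r + s / 2 * Re ((1 + z) / (1 - z)))"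
      by simp
    also have "\<dots> = norm (f_map s z)"
      using rd by (simp add: exp_add norm_f_map r_def)
    finally show False
      using f1 by simp
  qed
qed

section \<open>Solving \<open>f_map s z = w\<close> near the origin\<close>

text \<open>On \<open>cball 0 d\<close> the Cayley transform has real part above
  \<open>1 / 2\<close> and derivative \<open>2 / (1 - z)^2\<close> of modulus at most 4. Thus
  \<open>exp (- (s / 4)) <= d\<close> gives invariance of the ball, and
  \<open>2 * s * exp (- (s / 4)) <= 1 / 2\<close> gives the contraction constant.\<close>

lemma f_map_unique_preimage:
  fixes w :: complex
  assumes d: "0 < d" "d \<le> 1 / 8" and s: "0 \<le> s" "exp (- (s / 4)) \<le> d" "2 * s * exp (- (s / 4)) \<le> 1 / 2"
    and w: "norm w \<le> 1"
  shows "\<exists>!z. z \<in> cball 0 d \<and> f_map s z = w"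
proof -
  define G where "G z = w * exp (- (of_real (s / 2) * ((1 + z) / (1 - z))))" for z
  have ne: "1 - z \<noteq> 0" if "z \<in> cball 0 d" for z :: complex
    using that d by auto
  have nG: "norm (exp (- (of_real (s / 2) * ((1 + z) / (1 - z))))) \<le> exp (- (s / 4))"
    if "z \<in> cball 0 d" for z :: complex
  proof -
    have "1 / 2 \<le> Re ((1 + z) / (1 - z))"
      using Re_cayley_bounds(1)[of d z] that d by auto
    then have "s / 2 * (1 / 2) \<le> s / 2 * Re ((1 + z) / (1 - z))"
      using s by (intro mult_left_mono) auto
    moreover have "Re (- (of_real (s / 2) * q)) = - (s / 2 * Re q)" for q
      by simp
    ultimately show ?thesis
      by (simp only: norm_exp_eq_Re exp_le_cancel_iff)
  qed
  have fix_iff: "G z = z \<longleftrightarrow> f_map s z = w" for z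
    unfolding G_def f_map_def by (auto simp: exp_minus field_simps)
  have maps: "G ` cball 0 d \<subseteq> cball 0 d"
  proof clarify
    fix z :: complex assume z: "z \<in> cball 0 d"
    have "norm (G z) \<le> 1 * exp (- (s / 4))"
      unfolding G_def norm_mult using w nG[OF z] by (intro mult_mono) auto
    then show "G z \<in> cball 0 d"
      using s by simp
  qed
  have lip: "norm (G x - G y) \<le> 1 / 2 * norm (x - y)" if xy: "x \<in> cball 0 d" "y \<in> cball 0 d" for x y
  proof (rule field_differentiable_bound[OF convex_cball _ _ xy])
    fix z :: complex assume z: "z \<in> cball 0 d"
    define G' where "G' = w * (exp (- (of_real (s / 2) * ((1 + z) / (1 - z)))) *
      (- (of_real (s / 2) * (2 / (1 - z)\<^sup>2))))"
    show "(G has_field_derivative G') (at z within cball 0 d)"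
    proof -
      have "((\<lambda>z. (1 + z) / (1 - z)) has_field_derivative 2 / (1 - z)\<^sup>2) (at z within cball 0 d)"
        using ne[OF z] by (auto intro!: derivative_eq_intros simp: power2_eq_square)
      then show ?thesis
        unfolding G_def[abs_def] G'_def
        by (intro DERIV_cmult DERIV_chain2[OF DERIV_exp] DERIV_minus)
    qed
    have "1 - norm z \<le> norm (1 - z)"
      using norm_triangle_ineq2[of 1 z] by simp
    then have "3 / 4 \<le> norm (1 - z)"
      using z d by simp
    then have "(3 / 4)\<^sup>2 \<le> (norm (1 - z))\<^sup>2"
      by (intro power_mono) auto
    then have "2 / (norm (1 - z))\<^sup>2 \<le> 2 / (3 / 4)\<^sup>2"
      by (intro divide_left_mono mult_pos_pos) (use \<open>3 / 4 \<le> norm (1 - z)\<close> in auto)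
    also have "(2::real) / (3 / 4)\<^sup>2 \<le> 4"
      by (simp add: power2_eq_square)
    finally have q: "2 / (norm (1 - z))\<^sup>2 \<le> 4" .
    have "norm G' \<le> 1 * (exp (- (s / 4)) * (s / 2 * 4))"
      unfolding G'_def norm_mult norm_minus_cancel norm_divide norm_power
      using w nG[OF z] q s by (intro mult_mono) auto
    also have "\<dots> \<le> 1 / 2"
      using s by (simp add: algebra_simps)
    finally show "norm G' \<le> 1 / 2" .
  qed
  have "\<exists>!z\<in>cball 0 d. G z = z"
    by (rule Banach_fix[where c = "1 / 2"])
      (use maps lip d in \<open>auto simp: dist_norm complete_eq_closed\<close>)
  then show ?thesis
    by (simp add: fix_iff)
qed

lemma eventually_f_map_unique_preimage:
  assumes "0 < d" "d \<le> 1 / 8"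
  shows "\<forall>\<^sub>F s in at_top. \<forall>w\<in>cball 0 1. \<exists>!z. z \<in> cball 0 d \<and> f_map s z = w"
proof -
  have "((\<lambda>s::real. exp (- (s / 4))) \<longlongrightarrow> 0) at_top"
    by real_asymp
  then have 1: "\<forall>\<^sub>F s::real in at_top. exp (- (s / 4)) < d"
    using assms by (auto dest: order_tendstoD)
  have "((\<lambda>s::real. 2 * s * exp (- (s / 4))) \<longlongrightarrow> 0) at_top"
    by real_asymp
  then have 2: "\<forall>\<^sub>F s::real in at_top. 2 * s * exp (- (s / 4)) < 1 / 2"
    by (rule order_tendstoD) simp
  show ?thesis
    using 1 2 eventually_ge_at_top[of 0]
    proof eventually_elim
    case (elim s)
    then show ?case
      using assms by (intro ballI f_map_unique_preimage) auto
  qed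
qed

section \<open>Squeezing \<open>K_set s t\<close> between discs\<close>

text \<open>Solvability at parameter \<open>s\<close> shows that \<open>f_map s\<close> is injective
  on the closure of \<open>Omega s\<close> and covers the closed disk, so \<open>chi s\<close> is a
  genuine inverse. Solvability at \<open>s - t\<close> yields the candidate point for a prescribed
  value in \<open>K_set s t\<close>.\<close>

lemma K_set_between_balls:
  assumes d: "0 < d" "d \<le> 1 / 8" and t: "t > 0"
    and s: "4 / d \<le> s"
    and pre: "\<And>w. norm w \<le> 1 \<Longrightarrow> \<exists>!z. z \<in> cball 0 d \<and> f_map s z = w"
    and pre': "\<And>w. norm w \<le> 1 \<Longrightarrow> \<exists>z. z \<in> cball 0 d \<and> f_map (s - t) z = w"
  shows "K_set s t \<subseteq> ball 0 (exp (- (t / 2 * (1 - 4 * d))))"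
    and "ball 0 (exp (- (t / 2 * (1 + 4 * d)))) \<subseteq> K_set s t"
proof -
  let ?C = "closure (Omega s)"
  have sub: "?C \<subseteq> cball 0 d"
    using Omega_subset_cball[OF d(1) s] by (simp add: closure_minimal)
  have ball: "ball 0 1 \<subseteq> f_map s ` ?C"
  proof
    fix w :: complex assume w: "w \<in> ball 0 1"
    then obtain z where z: "z \<in> cball 0 d" "f_map s z = w"
      using pre[of w] by auto
    then have "z \<in> Omega s"
      using w d by (auto simp: Omega_def)
    then show "w \<in> f_map s ` ?C"
      using z closure_subset by blast
  qed
  \<comment> \<open>Compactness extends the covering from the open disk to the boundary
    circle.\<close>
  have "compact (f_map s ` ?C)"
  proof (rule compact_continuous_image)
    show "continuous_on ?C (f_map s)"
      using continuous_on_subset[OF continuous_on_f_map sub] d by simp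
    show "compact ?C"
      using bounded_subset[OF bounded_cball sub] by (simp add: compact_eq_bounded_closed)
  qed
  then have "closure (ball 0 1) \<subseteq> f_map s ` ?C"
    using ball by (intro closure_minimal compact_imp_closed)
  then have onto: "cball 0 1 \<subseteq> f_map s ` ?C"
    by simp
  show "K_set s t \<subseteq> ball 0 (exp (- (t / 2 * (1 - 4 * d))))"
  proof
    fix k assume "k \<in> K_set s t"
    then obtain w where w: "norm w \<le> 1" and k: "k = f_map (s - t) (chi s w)"
      by (auto simp: K_set_def chi2_def)
    \<comment> \<open>\<open>inv_into\<close> is a right inverse only on the image, so surjectivity
      must come first.\<close>
    have "w \<in> f_map s ` ?C"
      using w onto by auto
    then have z: "chi s w \<in> ?C" "f_map s (chi s w) = w"
      unfolding chi_def by (auto intro: inv_into_into f_inv_into_f)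
    then have zd: "norm (chi s w) \<le> d"
      using sub by auto
    have "norm k \<le> 1 * exp (- (t / 2 * Re ((1 + chi s w) / (1 - chi s w))))"
      unfolding k norm_f_map_diff z(2) using w by (intro mult_right_mono) auto
    also have "\<dots> < exp (- (t / 2 * (1 - 4 * d)))"
      using Re_cayley_bounds(1)[OF d(1) _ zd] d t by simp
    finally show "k \<in> ball 0 (exp (- (t / 2 * (1 - 4 * d))))"
      by simp
  qed
  show "ball 0 (exp (- (t / 2 * (1 + 4 * d)))) \<subseteq> K_set s t"
  proof
    fix k :: complex assume "k \<in> ball 0 (exp (- (t / 2 * (1 + 4 * d))))"
    then have k: "norm k < exp (- (t / 2 * (1 + 4 * d)))"
      by simp
    also have "\<dots> \<le> 1"
      using t d by simp
    finally obtain z where z: "norm z \<le> d" "f_map (s - t) z = k"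
      using pre'[of k] by auto
    have "norm (f_map s z) = norm k * exp (t / 2 * Re ((1 + z) / (1 - z)))"
      using norm_f_map_diff[of s t z] z(2) by (simp add: exp_minus field_simps)
    also have "\<dots> < exp (- (t / 2 * (1 + 4 * d))) * exp (t / 2 * (1 + 4 * d))"
      using Re_cayley_bounds(2)[OF d(1) _ z(1)] d t k by (intro mult_strict_mono) auto
    also have "\<dots> = 1"
      by (simp flip: exp_add)
    finally have fz: "norm (f_map s z) < 1" .
    then have "z \<in> Omega s"
      using z d by (auto simp: Omega_def)
    then have zC: "z \<in> ?C"
      using closure_subset by blast
    \<comment> \<open>Injectivity ensures that \<open>chi s\<close> returns \<open>z\<close> itself.
      The bound \<open>norm (f_map s x) <= 1\<close> passes from \<open>Omega s\<close> to its
      closure by continuity, so uniqueness in \<open>pre\<close> applies.\<close>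
    have "inj_on (f_map s) ?C"
    proof (rule inj_onI)
      fix x y assume xy: "x \<in> ?C" "y \<in> ?C" "f_map s x = f_map s y"
      have "?C \<subseteq> cball 0 d \<inter> f_map s -` cball 0 1"
      proof (rule closure_minimal)
        show "Omega s \<subseteq> cball 0 d \<inter> f_map s -` cball 0 1"
          using Omega_subset_cball[OF d(1) s] unfolding Omega_def by force
        show "closed (cball 0 d \<inter> f_map s -` cball 0 1)"
          using d by (intro continuous_closed_preimage continuous_on_f_map) auto
      qed
      then have "norm (f_map s x) \<le> 1"
        using xy by auto
      then show "x = y"
        using pre xy sub by (metis subsetD)
    qed
    then have "chi s (f_map s z) = z"
      unfolding chi_def using zC by (rule inv_into_f_f)
    then have "k = chi2 s t (f_map s z)"
      using z by (simp add: chi2_def)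
    then show "k \<in> K_set s t"
      using fz by (auto simp: K_set_def)
  qed
qed

section \<open>Annuli, \<open>Sigma_set\<close> and the Hausdorff distance\<close>

lemma closed_annulus: "closed (annulus t)"
proof -
  have "annulus t = {z. exp (- t / 2) \<le> norm z} \<inter> {z. norm z \<le> exp (t / 2)}"
    by (auto simp: annulus_def)
  then show ?thesis
    by (auto intro!: closed_Int closed_Collect_le continuous_intros)
qed

lemma annulus_mono:
  assumes "p \<le> q"
  shows "annulus p \<subseteq> annulus q"
proof -
  have "exp (- q / 2) \<le> exp (- p / 2)" "exp (p / 2) \<le> exp (q / 2)"
    using assms by simp_all
  then show ?thesis
    unfolding annulus_def by (blast intro: order_trans)
qed

text \<open>Inversion swaps the circles of radii \<open>exp (- (p / 2))\<close> and
  \<open>exp (p / 2)\<close>, so a bound on \<open>K_set s t\<close> controls both boundaries.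
  Complements reverse the inclusions.\<close>

lemma Sigma_set_between_annuli:
  assumes "K_set s t \<subseteq> ball 0 (exp (- (p / 2)))" "ball 0 (exp (- (q / 2))) \<subseteq> K_set s t"
  shows "annulus p \<subseteq> Sigma_set s t" "Sigma_set s t \<subseteq> annulus q"
proof -
  show "annulus p \<subseteq> Sigma_set s t"
  proof
    fix w assume "w \<in> annulus p"
    then have w: "exp (- (p / 2)) \<le> norm w" "norm w \<le> exp (p / 2)"
      by (auto simp: annulus_def)
    have "w \<noteq> 1 / z" if "z \<in> K_set s t" for z
    proof
      assume wz: "w = 1 / z"
      have "norm z < exp (- (p / 2))"
        using that assms(1) by auto
      \<comment> \<open>The convention \<open>1 / 0 = 0\<close> would give \<open>w = 0\<close>,
        which is outside the annulus.\<close>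
      moreover have "z \<noteq> 0"
        using w(1) wz by auto
      ultimately have "exp (p / 2) < norm w"
        unfolding wz by (simp add: norm_divide exp_minus field_simps)
      then show False
        using w by simp
    qed
    moreover have "w \<notin> K_set s t"
      using w assms(1) by auto
    ultimately show "w \<in> Sigma_set s t"
      by (auto simp: Sigma_set_def)
  qed
  show "Sigma_set s t \<subseteq> annulus q"
  proof
    fix w assume w: "w \<in> Sigma_set s t"
    then have "w \<notin> K_set s t"
      by (auto simp: Sigma_set_def)
    then have 1: "exp (- (q / 2)) \<le> norm w"
      using assms(2) by (metis linorder_not_le mem_ball_0 subsetD)
    then have w0: "w \<noteq> 0"
      by auto
    have "w = 1 / (1 / w)"
      by simp
    then have "1 / w \<notin> K_set s t"
      using w unfolding Sigma_set_def by blast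
    then have "exp (- (q / 2)) \<le> norm (1 / w)"
      using assms(2) by (metis linorder_not_le mem_ball_0 subsetD)
    then have "norm w \<le> exp (q / 2)"
      using w0 by (simp add: norm_divide exp_minus field_simps)
    then show "w \<in> annulus q"
      using 1 by (simp add: annulus_def)
  qed
qed

text \<open>Project radially: \<open>c\<close> is \<open>norm a\<close> clamped to the radii of
  \<open>annulus p\<close>, and \<open>b\<close> is the point of modulus \<open>c\<close> on the ray
  through \<open>a\<close>.\<close>

lemma annulus_nearby:
  assumes "0 \<le> p" "p \<le> q" "a \<in> annulus q"
  shows "\<exists>b\<in>annulus p. dist a b \<le> exp (q / 2) - exp (p / 2)"
proof -
  define c where "c = max (exp (- p / 2)) (min (exp (p / 2)) (norm a))"
  have a: "exp (- q / 2) \<le> norm a" "norm a \<le> exp (q / 2)" "0 < norm a"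
    using assms(3) by (auto simp: annulus_def intro: less_le_trans[OF exp_gt_zero])
  have pq: "exp (- p / 2) \<le> exp (p / 2)" "exp (p / 2) \<le> exp (q / 2)"
    using assms by auto
  define b where "b = of_real (c / norm a) * a"
  have c0: "0 < c"
    by (simp add: c_def less_max_iff_disj)
  then have "norm b = c"
    using a by (simp add: b_def norm_mult norm_divide)
  then have "b \<in> annulus p"
    using pq by (auto simp: annulus_def c_def)
  moreover have "dist a b \<le> exp (q / 2) - exp (p / 2)"
  proof -
    \<comment> \<open>The inner gap is the outer gap times a factor at most 1, as
      \<open>p + q >= 0\<close>.\<close>
    have "exp (- p / 2) - exp (- q / 2) = (exp (q / 2) - exp (p / 2)) * exp (- (p + q) / 2)"
      by (simp add: left_diff_distrib add_divide_distrib diff_divide_distrib flip: exp_add)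
    also have "\<dots> \<le> (exp (q / 2) - exp (p / 2)) * 1"
      using assms by (intro mult_left_mono) auto
    finally have *: "exp (- p / 2) - exp (- q / 2) \<le> exp (q / 2) - exp (p / 2)"
      by simp
    have "a - b = of_real (1 - c / norm a) * a"
      by (simp add: b_def algebra_simps)
    then have "dist a b = \<bar>1 - c / norm a\<bar> * norm a"
      by (simp only: dist_norm norm_mult norm_of_real)
    also have "\<dots> = \<bar>(1 - c / norm a) * norm a\<bar>"
      by (simp add: abs_mult)
    also have "(1 - c / norm a) * norm a = norm a - c"
      using a by (simp add: field_simps)
    also have "\<bar>norm a - c\<bar> \<le> exp (q / 2) - exp (p / 2)"
      using * a pq unfolding c_def by (auto simp: max_def min_def abs_if)
    finally show ?thesis .
  qed
  ultimately show ?thesis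
    by blast
qed

lemma hausdorff_dist_le:
  assumes "\<And>a. a \<in> A \<Longrightarrow> \<exists>b\<in>B. dist a b \<le> e" "\<And>b. b \<in> B \<Longrightarrow> \<exists>a\<in>A. dist a b \<le> e"
  shows "hausdorff_dist A B \<le> ennreal e"
  unfolding hausdorff_dist_def
proof (intro max.boundedI SUP_least)
  fix a assume "a \<in> A"
  then obtain b where "b \<in> B" "dist a b \<le> e"
    using assms(1) by blast
  then show "(INF b\<in>B. ennreal (dist a b)) \<le> ennreal e"
    by (intro INF_lower2[of b] ennreal_leI)
next
  fix b assume "b \<in> B"
  then obtain a where "a \<in> A" "dist a b \<le> e"
    using assms(2) by blast
  then show "(INF a\<in>A. ennreal (dist a b)) \<le> ennreal e"
    by (intro INF_lower2[of a] ennreal_leI)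
qed

text \<open>Both sets lie between \<open>annulus p\<close> and \<open>annulus q\<close>, so a point
  of either is close to a point of \<open>annulus p\<close>, which belongs to the other.\<close>

lemma hausdorff_dist_between_annuli:
  assumes "0 \<le> p" "p \<le> t" "t \<le> q" "annulus p \<subseteq> A" "A \<subseteq> annulus q"
  shows "hausdorff_dist A (annulus t) \<le> ennreal (exp (q / 2) - exp (p / 2))"
proof (rule hausdorff_dist_le)
  fix a assume "a \<in> A"
  then have "a \<in> annulus q"
    using assms by blast
  then obtain b where "b \<in> annulus p" "dist a b \<le> exp (q / 2) - exp (p / 2)"
    using annulus_nearby[of p q a] assms by auto
  then show "\<exists>b\<in>annulus t. dist a b \<le> exp (q / 2) - exp (p / 2)"
    using annulus_mono[OF assms(2)] by blast
next
  fix b assume "b \<in> annulus t"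
  then have "b \<in> annulus q"
    using annulus_mono[OF assms(3)] by blast
  then obtain a where "a \<in> annulus p" "dist b a \<le> exp (q / 2) - exp (p / 2)"
    using annulus_nearby[of p q b] assms by auto
  then show "\<exists>a\<in>A. dist a b \<le> exp (q / 2) - exp (p / 2)"
    using assms(4) by (auto simp: dist_commute)
qed

section \<open>Passage to the limit\<close>

lemma eventually_Sigma_set_between_annuli:
  assumes "t > 0" "0 < d" "d \<le> 1 / 8"
  shows "\<forall>\<^sub>F s in at_top. annulus (t * (1 - 4 * d)) \<subseteq> closure (Sigma_set s t) \<and>
    closure (Sigma_set s t) \<subseteq> annulus (t * (1 + 4 * d))"
proof -
  have *: "\<forall>\<^sub>F s in at_top. \<forall>w\<in>cball 0 1. \<exists>!z. z \<in> cball 0 d \<and> f_map s z = w"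
    using eventually_f_map_unique_preimage assms by blast
  have "filterlim (\<lambda>s::real. s - t) at_top at_top"
    by real_asymp
  with * have "\<forall>\<^sub>F s in at_top. \<forall>w\<in>cball 0 1. \<exists>!z. z \<in> cball 0 d \<and> f_map (s - t) z = w"
    by (rule eventually_compose_filterlim)
  with * show ?thesis
    using eventually_ge_at_top[of "4 / d"]
  proof eventually_elim
    case (elim s)
    have "K_set s t \<subseteq> ball 0 (exp (- (t / 2 * (1 - 4 * d))))"
      and "ball 0 (exp (- (t / 2 * (1 + 4 * d)))) \<subseteq> K_set s t"
      by (rule K_set_between_balls; use elim assms in \<open>force simp: Ex1_def\<close>)+
    then have "annulus (t * (1 - 4 * d)) \<subseteq> Sigma_set s t" "Sigma_set s t \<subseteq> annulus (t * (1 + 4 * d))"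
      by (intro Sigma_set_between_annuli; simp)+
    then show ?case
      \<comment> \<open>The outer annulus is closed, so taking the closure preserves both
        inclusions.\<close>
      using closure_subset closure_minimal[OF _ closed_annulus] by blast
  qed
qed

theorem corollary4p26:
  fixes t :: real
  assumes "t > 0"
  shows "((\<lambda>s. hausdorff_dist (closure (Sigma_set s t)) (annulus t)) \<longlongrightarrow> 0) at_top"
proof (rule order_tendstoI)
  fix e :: ennreal assume "0 < e"
  \<comment> \<open>This is the distance bound for \<open>p = t * (1 - 4 * d)\<close> and
    \<open>q = t * (1 + 4 * d)\<close>; it is continuous with \<open>g 0 = 0\<close>.\<close>
  define g where "g d = exp (t * (1 + 4 * d) / 2) - exp (t * (1 - 4 * d) / 2)" for d
  have "((\<lambda>d. ennreal (g d)) \<longlongrightarrow> ennreal (g 0)) (at_right 0)"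
    unfolding g_def by (intro tendsto_intros) auto
  then have "\<forall>\<^sub>F d in at_right 0. ennreal (g d) < e"
    using \<open>0 < e\<close> by (intro order_tendstoD(2)[where y = "ennreal (g 0)"]) (auto simp: g_def)
  moreover have "\<forall>\<^sub>F d in at_right 0. d \<in> {0<..<1 / 8 :: real}"
    by (rule eventually_at_right_real) simp
  ultimately have "\<forall>\<^sub>F d in at_right 0. ennreal (g d) < e \<and> 0 < d \<and> d < 1 / 8"
    by eventually_elim simp
  then obtain d where d: "ennreal (g d) < e" "0 < d" "d < 1 / 8"
    using eventually_happens'[OF trivial_limit_at_right_real] by blast
  have "\<forall>\<^sub>F s in at_top. annulus (t * (1 - 4 * d)) \<subseteq> closure (Sigma_set s t) \<and>
      closure (Sigma_set s t) \<subseteq> annulus (t * (1 + 4 * d))"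
    using assms d by (intro eventually_Sigma_set_between_annuli) auto
  then show "\<forall>\<^sub>F s in at_top. hausdorff_dist (closure (Sigma_set s t)) (annulus t) < e"
  proof eventually_elim
    case (elim s)
    have "hausdorff_dist (closure (Sigma_set s t)) (annulus t) \<le> ennreal (g d)"
      unfolding g_def using elim assms d by (intro hausdorff_dist_between_annuli) auto
    then show ?case
      using d(1) by (rule le_less_trans)
  qed
\<comment> \<open>The remaining half of the order criterion is vacuous: no \<open>ennreal\<close>
  lies below 0.\<close>
qed simp

end
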